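(* Let $(M,\varphi,\xi,\eta,g)$ be an almost contact B-metric manifold belonging to the class $\mathcal{U}$. Then for all vector fields $x,y,z,w\in\mathfrak{X}(M)$, $$2R(x,y,\varphi^2 z,\varphi^2 w)+2R(x,y,\varphi z,\varphi w)=(h\odot h)(x,y,z,w)+(h\odot h)(x,y,\varphi z,\varphi w),$$ where $h(x,y)=(\nabla_x\eta)y$.
   Context: An almost contact B-metric manifold $(M,\varphi,\xi,\eta,g)$ is a $(2n+1)$-dimensional differentiable manifold $M$ with an endomorphism $\varphi$ of the tangent bundle, a vector field $\xi$, a 1-form $\eta$, and a pseudo-Riemannian metric $g$ of signature $(n,n+1)$ ($n$ negative and $n+1$ positive directions) such that $$\varphi\xi=0,\quad \varphi^2=-\mathrm{Id}+\eta\otimes\xi,\quad \eta\circ\varphi=0,\quad \eta(\xi)=1,\quad g(\varphi x,\varphi y)=-g(x,y)+\eta(x)\eta(y)$$ for all $x,y\in\mathfrak{X}(M)$ (the smooth vector fields on $M$). Let $\nabla$ be the Levi-Civita connection of $g$ and $F(x,y,z)=g\big((\nabla_x\varphi)y,z\big)$. The class $\mathcal{U}$ consists of the almost contact B-metric manifolds satisfying, for all $x,y,z\in\mathfrak{X}(M)$, $$F(x,y,z)=\eta(y)F(x,z,\xi)+\eta(z)F(x,y,\xi),\qquad F(\xi,y,z)=0.$$ The curvature tensor is $R(x,y)z=\nabla_x\nabla_y z-\nabla_y\nabla_x z-\nabla_{[x,y]}z$, and $R(x,y,z,w)=g(R(x,y)z,w)$. For two $(0,2)$-tensors $a,b$,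 the Kulkarni–Nomizu product is $$(a\odot b)(x,y,z,w)=a(x,z)b(y,w)-a(y,z)b(x,w)+a(y,w)b(x,z)-a(x,w)b(y,z).$$ *)

theory Defs
  imports "HOL-Analysis.Analysis" "HOL-Library.Function_Algebras"
begin

subsection \<open>Functions with values in a real vector space form a real vector space\<close>

instantiation "fun" :: (type, real_vector) real_vector
begin

definition scaleR_fun :: "real \<Rightarrow> ('a \<Rightarrow> 'b) \<Rightarrow> 'a \<Rightarrow> 'b" where
  "scaleR_fun c f = (\<lambda>x. c *\<^sub>R f x)"

instance
  by standard (auto simp: scaleR_fun_def fun_eq_iff algebra_simps)

end

subsection \<open>Smooth manifolds\<close>

text \<open>
  \<open>Ck_on k S f\<close>: the map \<open>f\<close> is of class \<open>C\<close> to the \<open>k\<close> on \<open>S\<close>. It is only meant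
  (and only used) for open \<open>S\<close>.
\<close>

primrec Ck_on :: "nat \<Rightarrow> 'e::euclidean_space set \<Rightarrow> ('e \<Rightarrow> 'f::real_normed_vector) \<Rightarrow> bool" where
  "Ck_on 0 S f \<longleftrightarrow> continuous_on S f"
| "Ck_on (Suc k) S f \<longleftrightarrow>
     (\<forall>x\<in>S. f differentiable (at x)) \<and>
     (\<forall>v. Ck_on k S (\<lambda>x. frechet_derivative f (at x) v))"

definition smooth_on :: "'e::euclidean_space set \<Rightarrow> ('e \<Rightarrow> 'f::real_normed_vector) \<Rightarrow> bool" where
  "smooth_on S f \<longleftrightarrow> (\<forall>k. Ck_on k S f)"

text \<open>A chart is a pair of its domain and the coordinate map (relevant only on the domain).\<close>

type_synonym ('m, 'e) chart = "'m set \<times> ('m \<Rightarrow> 'e)"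

definition is_chart :: "('m::topological_space, 'e::euclidean_space) chart \<Rightarrow> bool" where
  "is_chart = (\<lambda>(U, c). open U \<and> open (c ` U) \<and> homeomorphism U (c ` U) c (inv_into U c))"

text \<open>
  The manifold is the whole (Hausdorff, second countable) type \<open>'m\<close>, and its dimension is the
  dimension of the model space \<open>'e\<close>. The atlas need not be maximal.
\<close>

locale smooth_manifold =
  fixes atlas :: "('m::{t2_space,second_countable_topology}, 'e::euclidean_space) chart set"
  assumes charts: "\<And>C. C \<in> atlas \<Longrightarrow> is_chart C"
    and cover: "(\<Union>C\<in>atlas. fst C) = UNIV"
    and smooth_transition: "\<And>U c V d. (U, c) \<in> atlas \<Longrightarrow> (V, d) \<in> atlas \<Longrightarrow>
      smooth_on (c ` (U \<inter> V)) (d \<circ> inv_into U c)"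

definition smooth_fun :: "('m::topological_space, 'e::euclidean_space) chart set \<Rightarrow> ('m \<Rightarrow> real) \<Rightarrow> bool"
  where "smooth_fun atlas f \<longleftrightarrow> (\<forall>(U, c)\<in>atlas. smooth_on (c ` U) (f \<circ> inv_into U c))"

subsection \<open>Tangent vectors and vector fields\<close>

text \<open>
  Tangent vectors at \<open>p\<close> are the derivations at \<open>p\<close> of the algebra of smooth functions. They are
  extended by \<open>0\<close> to non-smooth functions, so that equality of functions is equality of
  derivations and the tangent space is a linear subspace of the function space.
\<close>

type_synonym 'm tangent_vector = "('m \<Rightarrow> real) \<Rightarrow> real"

definition tangent_space ::
  "('m::topological_space, 'e::euclidean_space) chart set \<Rightarrow> 'm \<Rightarrow> 'm tangent_vector set" where
  "tangent_space atlas p = {v.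
     (\<forall>f g. smooth_fun atlas f \<longrightarrow> smooth_fun atlas g \<longrightarrow> v (\<lambda>q. f q + g q) = v f + v g) \<and>
     (\<forall>a f. smooth_fun atlas f \<longrightarrow> v (\<lambda>q. a * f q) = a * v f) \<and>
     (\<forall>f g. smooth_fun atlas f \<longrightarrow> smooth_fun atlas g \<longrightarrow>
        v (\<lambda>q. f q * g q) = v f * g p + f p * v g) \<and>
     (\<forall>f. \<not> smooth_fun atlas f \<longrightarrow> v f = 0)}"

type_synonym 'm vector_field = "'m \<Rightarrow> 'm tangent_vector"

definition vector_fields ::
  "('m::topological_space, 'e::euclidean_space) chart set \<Rightarrow> 'm vector_field set" where
  "vector_fields atlas = {X. (\<forall>p. X p \<in> tangent_space atlas p) \<and>
     (\<forall>f. smooth_fun atlas f \<longrightarrow> smooth_fun atlas (\<lambda>p. X p f))}"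

definition fscale :: "('m \<Rightarrow> real) \<Rightarrow> 'm vector_field \<Rightarrow> 'm vector_field" where
  "fscale f X = (\<lambda>p. f p *\<^sub>R X p)"

definition lie_bracket :: "'m vector_field \<Rightarrow> 'm vector_field \<Rightarrow> 'm vector_field" where
  "lie_bracket X Y = (\<lambda>p f. X p (\<lambda>q. Y q f) - Y p (\<lambda>q. X q f))"

subsection \<open>Tensor fields\<close>

text \<open>
  Endomorphisms of the tangent bundle, 1-forms and (0,2)-tensors are families of (multi)linear
  maps on the tangent spaces; their values off the tangent spaces are irrelevant.
\<close>

type_synonym 'm endo_field = "'m \<Rightarrow> 'm tangent_vector \<Rightarrow> 'm tangent_vector"
type_synonym 'm one_form = "'m \<Rightarrow> 'm tangent_vector \<Rightarrow> real"
type_synonym 'm two_tensor = "'m \<Rightarrow> 'm tangent_vector \<Rightarrow> 'm tangent_vector \<Rightarrow> real"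

definition ap_endo :: "'m endo_field \<Rightarrow> 'm vector_field \<Rightarrow> 'm vector_field" where
  "ap_endo A X = (\<lambda>p. A p (X p))"

definition ap_form :: "'m one_form \<Rightarrow> 'm vector_field \<Rightarrow> 'm \<Rightarrow> real" where
  "ap_form a X = (\<lambda>p. a p (X p))"

definition ap_two :: "'m two_tensor \<Rightarrow> 'm vector_field \<Rightarrow> 'm vector_field \<Rightarrow> 'm \<Rightarrow> real" where
  "ap_two b X Y = (\<lambda>p. b p (X p) (Y p))"

definition smooth_endo ::
  "('m::topological_space, 'e::euclidean_space) chart set \<Rightarrow> 'm endo_field \<Rightarrow> bool" where
  "smooth_endo atlas A \<longleftrightarrow>
     (\<forall>p. \<forall>u\<in>tangent_space atlas p. A p u \<in> tangent_space atlas p) \<and>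
     (\<forall>p. \<forall>u\<in>tangent_space atlas p. \<forall>v\<in>tangent_space atlas p. A p (u + v) = A p u + A p v) \<and>
     (\<forall>p. \<forall>u\<in>tangent_space atlas p. \<forall>c. A p (c *\<^sub>R u) = c *\<^sub>R A p u) \<and>
     (\<forall>X\<in>vector_fields atlas. ap_endo A X \<in> vector_fields atlas)"

definition smooth_one_form ::
  "('m::topological_space, 'e::euclidean_space) chart set \<Rightarrow> 'm one_form \<Rightarrow> bool" where
  "smooth_one_form atlas a \<longleftrightarrow>
     (\<forall>p. \<forall>u\<in>tangent_space atlas p. \<forall>v\<in>tangent_space atlas p. a p (u + v) = a p u + a p v) \<and>
     (\<forall>p. \<forall>u\<in>tangent_space atlas p. \<forall>c. a p (c *\<^sub>R u) = c * a p u) \<and>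
     (\<forall>X\<in>vector_fields atlas. smooth_fun atlas (ap_form a X))"

definition symmetric_two_tensor ::
  "('m::topological_space, 'e::euclidean_space) chart set \<Rightarrow> 'm two_tensor \<Rightarrow> bool" where
  "symmetric_two_tensor atlas b \<longleftrightarrow>
     (\<forall>p. \<forall>u\<in>tangent_space atlas p. \<forall>v\<in>tangent_space atlas p. b p u v = b p v u) \<and>
     (\<forall>p. \<forall>u\<in>tangent_space atlas p. \<forall>v\<in>tangent_space atlas p. \<forall>w\<in>tangent_space atlas p.
        b p (u + v) w = b p u w + b p v w) \<and>
     (\<forall>p. \<forall>u\<in>tangent_space atlas p. \<forall>w\<in>tangent_space atlas p. \<forall>c.
        b p (c *\<^sub>R u) w = c * b p u w) \<and>
     (\<forall>X\<in>vector_fields atlas. \<forall>Y\<in>vector_fields atlas. smooth_fun atlas (ap_two b X Y))"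

text \<open>
  Signature with \<open>r\<close> negative and \<open>s\<close> positive directions: every tangent space has a basis
  that is orthonormal of this type (hence \<open>b\<close> is nondegenerate).
\<close>

definition has_signature ::
  "('m::topological_space, 'e::euclidean_space) chart set \<Rightarrow> 'm two_tensor \<Rightarrow> nat \<Rightarrow> nat \<Rightarrow> bool" where
  "has_signature atlas b r s \<longleftrightarrow> (\<forall>p. \<exists>e :: nat \<Rightarrow> 'm tangent_vector.
     inj_on e {..<r + s} \<and> independent (e ` {..<r + s}) \<and>
     span (e ` {..<r + s}) = tangent_space atlas p \<and>
     (\<forall>i<r + s. \<forall>j<r + s.
        b p (e i) (e j) = (if i \<noteq> j then 0 else if i < r then - 1 else 1)))"

subsection \<open>Connections and curvature\<close>

text \<open>A connection is relevant only on \<open>vector_fields atlas\<close>.\<close>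

type_synonym 'm connection = "'m vector_field \<Rightarrow> 'm vector_field \<Rightarrow> 'm vector_field"

locale affine_connection = smooth_manifold atlas
  for atlas :: "('m::{t2_space,second_countable_topology}, 'e::euclidean_space) chart set" +
  fixes nabla :: "'m connection"
  assumes nabla_closed: "\<And>X Y. X \<in> vector_fields atlas \<Longrightarrow> Y \<in> vector_fields atlas \<Longrightarrow>
      nabla X Y \<in> vector_fields atlas"
    and nabla_add_left: "\<And>X X' Y. X \<in> vector_fields atlas \<Longrightarrow> X' \<in> vector_fields atlas \<Longrightarrow>
      Y \<in> vector_fields atlas \<Longrightarrow> nabla (X + X') Y = nabla X Y + nabla X' Y"
    and nabla_fscale_left: "\<And>f X Y. smooth_fun atlas f \<Longrightarrow> X \<in> vector_fields atlas \<Longrightarrow>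
      Y \<in> vector_fields atlas \<Longrightarrow> nabla (fscale f X) Y = fscale f (nabla X Y)"
    and nabla_add_right: "\<And>X Y Y'. X \<in> vector_fields atlas \<Longrightarrow> Y \<in> vector_fields atlas \<Longrightarrow>
      Y' \<in> vector_fields atlas \<Longrightarrow> nabla X (Y + Y') = nabla X Y + nabla X Y'"
    and nabla_fscale_right: "\<And>f X Y. smooth_fun atlas f \<Longrightarrow> X \<in> vector_fields atlas \<Longrightarrow>
      Y \<in> vector_fields atlas \<Longrightarrow>
      nabla X (fscale f Y) = fscale (\<lambda>p. X p f) Y + fscale f (nabla X Y)"

locale levi_civita_connection = affine_connection atlas nabla
  for atlas :: "('m::{t2_space,second_countable_topology}, 'e::euclidean_space) chart set"
    and g :: "'m two_tensor" and nabla :: "'m connection" +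
  assumes torsion_free: "\<And>X Y. X \<in> vector_fields atlas \<Longrightarrow> Y \<in> vector_fields atlas \<Longrightarrow>
      nabla X Y - nabla Y X = lie_bracket X Y"
    and metric: "\<And>X Y Z p. X \<in> vector_fields atlas \<Longrightarrow> Y \<in> vector_fields atlas \<Longrightarrow>
      Z \<in> vector_fields atlas \<Longrightarrow>
      X p (ap_two g Y Z) = ap_two g (nabla X Y) Z p + ap_two g Y (nabla X Z) p"

definition nabla_endo ::
  "'m connection \<Rightarrow> 'm endo_field \<Rightarrow> 'm vector_field \<Rightarrow> 'm vector_field \<Rightarrow> 'm vector_field" where
  "nabla_endo nabla A X Y = nabla X (ap_endo A Y) - ap_endo A (nabla X Y)"

definition nabla_form ::
  "'m connection \<Rightarrow> 'm one_form \<Rightarrow> 'm vector_field \<Rightarrow> 'm vector_field \<Rightarrow> 'm \<Rightarrow> real" where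
  "nabla_form nabla a X Y = (\<lambda>p. X p (ap_form a Y) - ap_form a (nabla X Y) p)"

definition curvature ::
  "'m connection \<Rightarrow> 'm vector_field \<Rightarrow> 'm vector_field \<Rightarrow> 'm vector_field \<Rightarrow> 'm vector_field" where
  "curvature nabla X Y Z =
     nabla X (nabla Y Z) - nabla Y (nabla X Z) - nabla (lie_bracket X Y) Z"

definition curvature4 :: "'m two_tensor \<Rightarrow> 'm connection \<Rightarrow>
    'm vector_field \<Rightarrow> 'm vector_field \<Rightarrow> 'm vector_field \<Rightarrow> 'm vector_field \<Rightarrow> 'm \<Rightarrow> real" where
  "curvature4 g nabla X Y Z W = ap_two g (curvature nabla X Y Z) W"

text \<open>Here (0,2)-tensors are given by their action on vector fields.\<close>

definition kulkarni_nomizu ::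
  "('m vector_field \<Rightarrow> 'm vector_field \<Rightarrow> 'm \<Rightarrow> real) \<Rightarrow>
   ('m vector_field \<Rightarrow> 'm vector_field \<Rightarrow> 'm \<Rightarrow> real) \<Rightarrow>
   'm vector_field \<Rightarrow> 'm vector_field \<Rightarrow> 'm vector_field \<Rightarrow> 'm vector_field \<Rightarrow> 'm \<Rightarrow> real"
  (infixl "\<odot>" 70) where
  "(a \<odot> b) x y z w = (\<lambda>p. a x z p * b y w p - a y z p * b x w p
      + a y w p * b x z p - a x w p * b y z p)"

subsection \<open>Almost contact B-metric manifolds\<close>

locale almost_contact_B_metric_manifold = smooth_manifold atlas
  for atlas :: "('m::{t2_space,second_countable_topology}, 'e::euclidean_space) chart set" +
  fixes n :: nat
    and \<phi> :: "'m endo_field" and \<xi> :: "'m vector_field"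
    and \<eta> :: "'m one_form" and g :: "'m two_tensor"
  assumes dim: "DIM('e) = 2 * n + 1"
    and phi: "smooth_endo atlas \<phi>"
    and xi: "\<xi> \<in> vector_fields atlas"
    and eta: "smooth_one_form atlas \<eta>"
    and g: "symmetric_two_tensor atlas g"
    and signature: "has_signature atlas g n (n + 1)"
    and phi_xi: "ap_endo \<phi> \<xi> = 0"
    and phi_phi: "\<And>x. x \<in> vector_fields atlas \<Longrightarrow>
      ap_endo \<phi> (ap_endo \<phi> x) = - x + fscale (ap_form \<eta> x) \<xi>"
    and eta_phi: "\<And>x p. x \<in> vector_fields atlas \<Longrightarrow> ap_form \<eta> (ap_endo \<phi> x) p = 0"
    and eta_xi: "\<And>p. ap_form \<eta> \<xi> p = 1"
    and g_phi: "\<And>x y p. x \<in> vector_fields atlas \<Longrightarrow> y \<in> vector_fields atlas \<Longrightarrow>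
      ap_two g (ap_endo \<phi> x) (ap_endo \<phi> y) p
        = - ap_two g x y p + ap_form \<eta> x p * ap_form \<eta> y p"

definition fundamental_F :: "'m two_tensor \<Rightarrow> 'm connection \<Rightarrow> 'm endo_field \<Rightarrow>
    'm vector_field \<Rightarrow> 'm vector_field \<Rightarrow> 'm vector_field \<Rightarrow> 'm \<Rightarrow> real" where
  "fundamental_F g nabla \<phi> x y z = ap_two g (nabla_endo nabla \<phi> x y) z"

text \<open>
  Almost contact B-metric manifolds in the class U; \<open>nabla\<close> is the Levi-Civita connection
  of \<open>g\<close>, uniquely determined on vector fields.
\<close>

locale class_U =
  almost_contact_B_metric_manifold atlas n \<phi> \<xi> \<eta> g + levi_civita_connection atlas g nabla
  for atlas :: "('m::{t2_space,second_countable_topology}, 'e::euclidean_space) chart set"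
    and n :: nat and \<phi> :: "'m endo_field" and \<xi> :: "'m vector_field"
    and \<eta> :: "'m one_form" and g :: "'m two_tensor" and nabla :: "'m connection" +
  assumes F_eq: "\<And>x y z p. x \<in> vector_fields atlas \<Longrightarrow> y \<in> vector_fields atlas \<Longrightarrow>
      z \<in> vector_fields atlas \<Longrightarrow>
      fundamental_F g nabla \<phi> x y z p =
        ap_form \<eta> y p * fundamental_F g nabla \<phi> x z \<xi> p
        + ap_form \<eta> z p * fundamental_F g nabla \<phi> x y \<xi> p"
    and F_xi: "\<And>y z p. y \<in> vector_fields atlas \<Longrightarrow> z \<in> vector_fields atlas \<Longrightarrow>
      fundamental_F g nabla \<phi> \<xi> y z p = 0"

end

theory Submission
  imports Defs
begin

text \<open>
  On fields \<open>z\<close>, \<open>w\<close> with \<open>\<eta>(z) = \<eta>(w) = 0\<close> the defining identity of the class gives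
  \<open>g(\<nabla>\<^sub>y \<phi>z, u) = g(\<phi>\<nabla>\<^sub>y z, u) - \<eta>(u) h(y, \<phi>z)\<close>. With metric compatibility this turns
  \<open>g(\<nabla>\<^sub>x\<nabla>\<^sub>y \<phi>z, \<phi>w)\<close> into
  \<open>- g(\<nabla>\<^sub>x\<nabla>\<^sub>y z, w) - h(y, z) h(x, w) - h(y, \<phi>z) h(x, \<phi>w)\<close>; antisymmetrising in \<open>x\<close>, \<open>y\<close>
  yields a formula for \<open>R(x, y, z, w) + R(x, y, \<phi>z, \<phi>w)\<close>, which is then applied to
  \<open>\<phi>z\<close>, \<open>\<phi>w\<close>.
\<close>

section \<open>Differences of smooth maps on open sets\<close>

lemma Ck_on_cong:
  assumes "open S" "\<And>x. x \<in> S \<Longrightarrow> f x = g x" "Ck_on k S f"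
  shows "Ck_on k S g"
  using assms(2,3)
proof (induction k arbitrary: f g)
  case 0
  then show ?case by (auto cong: continuous_on_cong)
next
  case (Suc k)
  \<comment> \<open>As \<open>S\<close> is open, \<open>f\<close> and \<open>g\<close> agree near
    each point of \<open>S\<close>, not only at it, so they share their derivative there.\<close>
  have deriv: "(g has_derivative frechet_derivative f (at x)) (at x)" if "x \<in> S" for x
  proof -
    have "(f has_derivative frechet_derivative f (at x)) (at x)"
      using Suc.prems(2) that frechet_derivative_works by auto
    then show ?thesis
      using has_derivative_transform_within_open[OF _ assms(1) that] Suc.prems(1) by blast
  qed
  then have "frechet_derivative g (at x) = frechet_derivative f (at x)" if "x \<in> S" for x
    using frechet_derivative_at that by metis
  then have "Ck_on k S (\<lambda>x. frechet_derivative g (at x) v)" for v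
    using Suc.prems(2) by - (rule Suc.IH[of "\<lambda>x. frechet_derivative f (at x) v"], auto)
  then show ?case using deriv by (auto simp: differentiable_def)
qed

lemma Ck_on_diff:
  assumes "open S" "Ck_on k S f" "Ck_on k S g"
  shows "Ck_on k S (\<lambda>x. f x - g x)"
  using assms(2,3)
proof (induction k arbitrary: f g)
  case 0
  then show ?case by (auto intro: continuous_intros)
next
  case (Suc k)
  have "frechet_derivative (\<lambda>x. f x - g x) (at x)
      = (\<lambda>v. frechet_derivative f (at x) v - frechet_derivative g (at x) v)" if "x \<in> S" for x
    using Suc.prems that
    by (intro frechet_derivative_at[symmetric] has_derivative_diff
        iffD1[OF frechet_derivative_works]) auto
  moreover have "Ck_on k S (\<lambda>x. frechet_derivative f (at x) v - frechet_derivative g (at x) v)" for v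
    using Suc by auto
  \<comment> \<open>The formula for the derivative holds on \<open>S\<close> only, hence the passage
    through \<open>Ck_on_cong\<close>.\<close>
  ultimately have "Ck_on k S (\<lambda>x. frechet_derivative (\<lambda>x. f x - g x) (at x) v)" for v
    by - (rule Ck_on_cong[OF assms(1),
        of "\<lambda>x. frechet_derivative f (at x) v - frechet_derivative g (at x) v"], auto)
  then show ?case using Suc.prems by auto
qed

section \<open>Tangent vectors as derivations, and vector fields\<close>

lemma tangent_const:
  assumes "v \<in> tangent_space atlas p"
  shows "v (\<lambda>_. c) = 0"
\<comment> \<open>On non-smooth functions \<open>v\<close> is 0 by convention, so the case split
  spares a proof that constants are smooth.\<close>
proof (cases "smooth_fun atlas (\<lambda>_. c)")
  case True
  show ?thesis
  proof (cases "c = 0")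
    case True
    have "v (\<lambda>q. 0 * c) = 0 * v (\<lambda>_. c)"
      using assms \<open>smooth_fun atlas (\<lambda>_. c)\<close> unfolding tangent_space_def by blast
    then show ?thesis using True by simp
  next
    case False
    \<comment> \<open>Homogeneity and the Leibniz rule evaluate \<open>v\<close> on the same
      constant as \<open>c * v c\<close> and as twice that.\<close>
    have "v (\<lambda>q. c * c) = c * v (\<lambda>_. c)"
      using assms True unfolding tangent_space_def by blast
    moreover have "v (\<lambda>q. c * c) = v (\<lambda>_. c) * c + c * v (\<lambda>_. c)"
      using assms True unfolding tangent_space_def by blast
    ultimately show ?thesis using False by simp
  qed
qed (use assms in \<open>simp add: tangent_space_def\<close>)

lemma tangent_uminus:
  assumes "v \<in> tangent_space atlas p" "smooth_fun atlas f"
  shows "v (\<lambda>q. - f q) = - v f"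
proof -
  have "v (\<lambda>q. (- 1) * f q) = (- 1) * v f"
    using assms unfolding tangent_space_def by blast
  then show ?thesis by simp
qed

lemma tangent_space_diff:
  assumes "u \<in> tangent_space atlas p" "v \<in> tangent_space atlas p"
  shows "u - v \<in> tangent_space atlas p"
  using assms unfolding tangent_space_def by (simp add: algebra_simps)

lemma vector_fields_tangent: "X \<in> vector_fields atlas \<Longrightarrow> X p \<in> tangent_space atlas p"
  by (simp add: vector_fields_def)

context smooth_manifold
begin

lemma smooth_fun_diff:
  assumes "smooth_fun atlas f" "smooth_fun atlas g"
  shows "smooth_fun atlas (\<lambda>p. f p - g p)"
proof -
  have "smooth_on (c ` U) ((\<lambda>p. f p - g p) \<circ> inv_into U c)" if "(U, c) \<in> atlas" for U c
  proof -
    have "open (c ` U)" using charts[OF that] by (simp add: is_chart_def)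
    moreover have "smooth_on (c ` U) (f \<circ> inv_into U c)" "smooth_on (c ` U) (g \<circ> inv_into U c)"
      using assms that by (auto simp: smooth_fun_def)
    ultimately show ?thesis
      by (simp add: smooth_on_def comp_def Ck_on_diff)
  qed
  then show ?thesis by (auto simp: smooth_fun_def)
qed

lemma vector_fields_diff:
  assumes "X \<in> vector_fields atlas" "Y \<in> vector_fields atlas"
  shows "X - Y \<in> vector_fields atlas"
  using assms by (simp add: vector_fields_def tangent_space_diff smooth_fun_diff)

end

section \<open>Pointwise algebra of the B-metric\<close>

context almost_contact_B_metric_manifold
begin

lemma ap_endo_closed: "X \<in> vector_fields atlas \<Longrightarrow> ap_endo \<phi> X \<in> vector_fields atlas"
  using phi by (simp add: smooth_endo_def)

lemma smooth_ap_two: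
  "X \<in> vector_fields atlas \<Longrightarrow> Y \<in> vector_fields atlas \<Longrightarrow> smooth_fun atlas (ap_two g X Y)"
  using g by (simp add: symmetric_two_tensor_def)

lemma ap_two_commute:
  "X \<in> vector_fields atlas \<Longrightarrow> Y \<in> vector_fields atlas \<Longrightarrow> ap_two g X Y p = ap_two g Y X p"
  using g by (simp add: symmetric_two_tensor_def ap_two_def vector_fields_tangent)

lemma ap_two_diff_left:
  assumes "X \<in> vector_fields atlas" "Y \<in> vector_fields atlas" "Z \<in> vector_fields atlas"
  shows "ap_two g (X - Y) Z p = ap_two g X Z p - ap_two g Y Z p"
proof -
  \<comment> \<open>Additivity is assumed for sums only; splitting \<open>X p\<close> as
    \<open>(X p - Y p) + Y p\<close> yields the difference.\<close>
  have "g p ((X p - Y p) + Y p) (Z p) = g p (X p - Y p) (Z p) + g p (Y p) (Z p)"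
    using g assms unfolding symmetric_two_tensor_def
    by (blast intro: vector_fields_tangent tangent_space_diff)
  then show ?thesis by (simp add: ap_two_def)
qed

text \<open>Put \<xi> into the compatibility of \<open>g\<close> with \<phi>: the left side vanishes
  because \<phi>\<xi> = 0, and \<eta>(\<xi>) = 1.\<close>

lemma ap_form_eq_ap_two:
  assumes "X \<in> vector_fields atlas"
  shows "ap_form \<eta> X p = ap_two g X \<xi> p"
proof -
  have "ap_two g (ap_endo \<phi> \<xi>) (ap_endo \<phi> X) p = 0"
    using ap_two_diff_left[OF ap_endo_closed[OF xi] ap_endo_closed[OF xi] ap_endo_closed[OF assms]]
    by (simp add: phi_xi)
  then show ?thesis
    using g_phi[OF xi assms, of p] ap_two_commute[OF xi assms] eta_xi by simp
qed

lemma ap_two_phi_phi: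
  assumes "X \<in> vector_fields atlas" "Z \<in> vector_fields atlas"
  shows "ap_two g (ap_endo \<phi> (ap_endo \<phi> X)) Z p
    = - ap_two g X Z p + ap_form \<eta> X p * ap_form \<eta> Z p"
proof -
  let ?u = "X p" and ?x = "\<xi> p" and ?a = "ap_form \<eta> X p"
  have tan: "?u \<in> tangent_space atlas p" "?x \<in> tangent_space atlas p" "Z p \<in> tangent_space atlas p"
    using assms xi by (simp_all add: vector_fields_tangent)
  have scale: "c *\<^sub>R v \<in> tangent_space atlas p" if "v \<in> tangent_space atlas p" for c v
    using that unfolding tangent_space_def by (simp add: scaleR_fun_def algebra_simps)
  \<comment> \<open>The negative is written as a multiple by \<open>- 1\<close>, so that additivity
    and homogeneity of \<open>g p\<close> apply directly.\<close>
  have "g p ((- 1) *\<^sub>R ?u + ?a *\<^sub>R ?x) (Z p) = g p ((- 1) *\<^sub>R ?u) (Z p) + g p (?a *\<^sub>R ?x) (Z p)"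
    using g tan scale unfolding symmetric_two_tensor_def by blast
  also have "\<dots> = (- 1) * g p ?u (Z p) + ?a * g p ?x (Z p)"
    using g tan unfolding symmetric_two_tensor_def by metis
  also have "g p ?x (Z p) = ap_form \<eta> Z p"
    using ap_form_eq_ap_two[OF assms(2)] ap_two_commute[OF assms(2) xi] by (simp add: ap_two_def)
  finally have "g p ((- 1) *\<^sub>R ?u + ?a *\<^sub>R ?x) (Z p) = - ap_two g X Z p + ?a * ap_form \<eta> Z p"
    by (simp only: ap_two_def mult_minus1)
  moreover have "ap_endo \<phi> (ap_endo \<phi> X) p = (- 1) *\<^sub>R ?u + ?a *\<^sub>R ?x"
    by (simp add: phi_phi[OF assms(1)] fscale_def)
  ultimately show ?thesis
    unfolding ap_two_def by (simp only:)
qed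

end

section \<open>The tensor \<open>h\<close> and covariant derivatives of \<phi>\<close>

context class_U
begin

abbreviation h where "h \<equiv> nabla_form nabla \<eta>"

text \<open>By torsion-freeness the bracket is a difference of two covariant derivatives, so its
  derivation property needs no direct check.\<close>

lemma lie_bracket_closed:
  assumes "X \<in> vector_fields atlas" "Y \<in> vector_fields atlas"
  shows "lie_bracket X Y \<in> vector_fields atlas"
  using vector_fields_diff[OF nabla_closed[OF assms] nabla_closed[OF assms(2,1)]]
  by (simp add: torsion_free assms)

text \<open>Since \<eta> is \<open>g\<close>-dual to \<xi>, metric compatibility applied to
  \<open>g(Y, \<xi>)\<close> leaves only the term with the derivative of \<xi>.\<close>

lemma h_eq_ap_two:
  assumes "X \<in> vector_fields atlas" "Y \<in> vector_fields atlas"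
  shows "h X Y p = ap_two g (nabla X \<xi>) Y p"
proof -
  have "ap_form \<eta> Y = ap_two g Y \<xi>" using ap_form_eq_ap_two[OF assms(2)] by blast
  then show ?thesis
    using metric[OF assms xi, of p] ap_two_commute[OF assms(2) nabla_closed[OF assms(1) xi]]
    by (simp add: nabla_form_def ap_form_eq_ap_two nabla_closed assms)
qed

text \<open>Differentiate the constant \<open>g(\<xi>, \<xi>) = 1\<close>.\<close>

lemma h_xi:
  assumes "X \<in> vector_fields atlas"
  shows "h X \<xi> p = 0"
proof -
  have "ap_form \<eta> \<xi> = (\<lambda>_. 1)" using eta_xi by blast
  moreover have "ap_form \<eta> \<xi> = ap_two g \<xi> \<xi>" using ap_form_eq_ap_two[OF xi] by blast
  ultimately have "0 = ap_two g (nabla X \<xi>) \<xi> p + ap_two g \<xi> (nabla X \<xi>) p"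
    using metric[OF assms xi xi, of p] tangent_const[OF vector_fields_tangent[OF assms]] by simp
  then show ?thesis
    using h_eq_ap_two[OF assms xi] ap_two_commute[OF xi nabla_closed[OF assms xi]] by simp
qed

text \<open>By \<open>h_xi\<close>, \<open>nabla X \<xi>\<close> is orthogonal to \<xi>, so the
  \<xi>-component of \<phi>\<phi>Y drops out of the pairing with it.\<close>

lemma h_phi_phi:
  assumes "X \<in> vector_fields atlas" "Y \<in> vector_fields atlas"
  shows "h X (ap_endo \<phi> (ap_endo \<phi> Y)) p = - h X Y p"
proof -
  note N = nabla_closed[OF assms(1) xi]
  have "ap_form \<eta> (nabla X \<xi>) p = 0"
    using h_xi[OF assms(1)] by (simp add: h_eq_ap_two ap_form_eq_ap_two assms xi N)
  then show ?thesis
    using ap_two_phi_phi[OF assms(2) N, of p]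
    by (simp add: h_eq_ap_two assms ap_endo_closed ap_two_commute[OF N])
qed

text \<open>\<eta>(Y) has to vanish everywhere, not only at \<open>p\<close>, because
  \<open>h\<close> contains its derivative along \<open>X\<close>.\<close>

lemma ap_form_nabla:
  assumes "X \<in> vector_fields atlas" "\<And>p. ap_form \<eta> Y p = 0"
  shows "ap_form \<eta> (nabla X Y) p = - h X Y p"
proof -
  have "ap_form \<eta> Y = (\<lambda>_. 0)" using assms(2) by blast
  then show ?thesis
    using tangent_const[OF vector_fields_tangent[OF assms(1)]] by (simp add: nabla_form_def)
qed

lemma ap_two_nabla_phi:
  assumes "X \<in> vector_fields atlas" "Y \<in> vector_fields atlas" "Z \<in> vector_fields atlas"
    and "\<And>p. ap_form \<eta> Y p = 0"
  shows "ap_two g (nabla X (ap_endo \<phi> Y)) Z p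
    = ap_two g (ap_endo \<phi> (nabla X Y)) Z p - ap_form \<eta> Z p * h X (ap_endo \<phi> Y) p"
proof -
  have F: "fundamental_F g nabla \<phi> X Y V p
      = ap_two g (nabla X (ap_endo \<phi> Y)) V p - ap_two g (ap_endo \<phi> (nabla X Y)) V p"
    if "V \<in> vector_fields atlas" for V
    using that assms
    by (simp add: fundamental_F_def nabla_endo_def ap_two_diff_left nabla_closed ap_endo_closed)
  \<comment> \<open>Pairing with \<xi> is \<eta>: it kills the \<phi>-image, and
    \<open>ap_form_nabla\<close> applies to \<phi>Y. As \<eta>(Y) = 0, this value determines all of
    \<open>F(X, Y, Z)\<close>.\<close>
  have "fundamental_F g nabla \<phi> X Y \<xi> p = - h X (ap_endo \<phi> Y) p"
    using assms eta_phi[OF nabla_closed[OF assms(1,2)], of p]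
      ap_form_nabla[OF assms(1) eta_phi[OF assms(2)], of p]
    by (simp add: F xi ap_form_eq_ap_two nabla_closed ap_endo_closed)
  then show ?thesis
    using F[OF assms(3)] F_eq[OF assms(1-3), of p] assms(4) by simp
qed

lemma ap_two_nabla_phi_phi:
  assumes "X \<in> vector_fields atlas" "Y \<in> vector_fields atlas" "Z \<in> vector_fields atlas"
    and "\<And>p. ap_form \<eta> Y p = 0" "\<And>p. ap_form \<eta> Z p = 0"
  shows "ap_two g (nabla X (ap_endo \<phi> Y)) (ap_endo \<phi> Z) p = - ap_two g (nabla X Y) Z p"
  using ap_two_nabla_phi[OF assms(1,2) ap_endo_closed[OF assms(3)] assms(4), of p] assms
  by (simp add: eta_phi g_phi nabla_closed)

lemma ap_two_nabla_phi_nabla_phi: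
  assumes "X \<in> vector_fields atlas" "Y \<in> vector_fields atlas"
    and "Z \<in> vector_fields atlas" "W \<in> vector_fields atlas"
    and "\<And>p. ap_form \<eta> Z p = 0" "\<And>p. ap_form \<eta> W p = 0"
  shows "ap_two g (nabla Y (ap_endo \<phi> Z)) (nabla X (ap_endo \<phi> W)) p
    = - ap_two g (nabla Y Z) (nabla X W) p + h Y Z p * h X W p
      + h Y (ap_endo \<phi> Z) p * h X (ap_endo \<phi> W) p"
proof -
  note VF = nabla_closed ap_endo_closed assms(1-4)
  \<comment> \<open>\<phi> is first pulled out of the derivative of \<phi>Z; symmetry of
    \<open>g\<close> then moves the derivative of \<phi>W to the first slot, where the same is done.
    Each product of two \<open>h\<close> comes from values of \<eta> on covariant
    derivatives.\<close>
  have "ap_two g (nabla Y (ap_endo \<phi> Z)) (nabla X (ap_endo \<phi> W)) p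
      = ap_two g (nabla X (ap_endo \<phi> W)) (ap_endo \<phi> (nabla Y Z)) p
        + h X (ap_endo \<phi> W) p * h Y (ap_endo \<phi> Z) p"
    using ap_form_nabla[OF assms(1) eta_phi[OF assms(4)]]
    by (subst ap_two_nabla_phi) (simp_all add: VF assms(5) ap_two_commute[of "ap_endo \<phi> (nabla Y Z)"])
  also have "ap_two g (nabla X (ap_endo \<phi> W)) (ap_endo \<phi> (nabla Y Z)) p
      = ap_two g (ap_endo \<phi> (nabla Y Z)) (ap_endo \<phi> (nabla X W)) p"
    by (subst ap_two_nabla_phi)
      (simp_all add: VF assms(6) eta_phi ap_two_commute[of "ap_endo \<phi> (nabla Y Z)"])
  also have "\<dots> = - ap_two g (nabla Y Z) (nabla X W) p + h Y Z p * h X W p"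
    using ap_form_nabla assms by (simp add: g_phi VF)
  finally show ?thesis by simp
qed

lemma ap_two_nabla_nabla_phi:
  assumes "X \<in> vector_fields atlas" "Y \<in> vector_fields atlas"
    and "Z \<in> vector_fields atlas" "W \<in> vector_fields atlas"
    and "\<And>p. ap_form \<eta> Z p = 0" "\<And>p. ap_form \<eta> W p = 0"
  shows "ap_two g (nabla X (nabla Y (ap_endo \<phi> Z))) (ap_endo \<phi> W) p
    = - ap_two g (nabla X (nabla Y Z)) W p - h Y Z p * h X W p
      - h Y (ap_endo \<phi> Z) p * h X (ap_endo \<phi> W) p"
proof -
  note VF = nabla_closed ap_endo_closed assms(1-4)
  \<comment> \<open>This must be an equality of functions, since \<open>X\<close> differentiates it.
    After metric compatibility on both sides, the products of two first derivatives cancel up to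
    terms in \<open>h\<close>.\<close>
  have "ap_two g (nabla Y (ap_endo \<phi> Z)) (ap_endo \<phi> W) = (\<lambda>p. - ap_two g (nabla Y Z) W p)"
    using ap_two_nabla_phi_phi[OF assms(2-6)] by blast
  then have "X p (ap_two g (nabla Y (ap_endo \<phi> Z)) (ap_endo \<phi> W)) = - X p (ap_two g (nabla Y Z) W)"
    by (simp add: tangent_uminus[OF vector_fields_tangent[OF assms(1)]] smooth_ap_two VF)
  then show ?thesis
    using metric[OF assms(1) nabla_closed[OF assms(2,3)] assms(4), of p]
      metric[OF assms(1) nabla_closed[OF assms(2) ap_endo_closed[OF assms(3)]]
        ap_endo_closed[OF assms(4)], of p]
      ap_two_nabla_phi_nabla_phi[OF assms, of p]
    by simp
qed

section \<open>The curvature identity\<close>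

lemma curvature4_eq:
  assumes "X \<in> vector_fields atlas" "Y \<in> vector_fields atlas"
    and "Z \<in> vector_fields atlas" "W \<in> vector_fields atlas"
  shows "curvature4 g nabla X Y Z W p = ap_two g (nabla X (nabla Y Z)) W p
    - ap_two g (nabla Y (nabla X Z)) W p - ap_two g (nabla (lie_bracket X Y) Z) W p"
  using assms
  by (simp add: curvature4_def curvature_def ap_two_diff_left vector_fields_diff nabla_closed
      lie_bracket_closed)

text \<open>In the sum of the two curvatures the second derivatives cancel down to products of
  \<open>h\<close>, and the bracket terms cancel by \<open>ap_two_nabla_phi_phi\<close>. The factor
  2 arises since \<open>(h \<odot> h) x y z w\<close> is twice
  \<open>h(x,z)h(y,w) - h(y,z)h(x,w)\<close>.\<close>

lemma curvature4_add_curvature4_phi: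
  assumes "X \<in> vector_fields atlas" "Y \<in> vector_fields atlas"
    and "Z \<in> vector_fields atlas" "W \<in> vector_fields atlas"
    and "\<And>p. ap_form \<eta> Z p = 0" "\<And>p. ap_form \<eta> W p = 0"
  shows "2 * curvature4 g nabla X Y Z W p + 2 * curvature4 g nabla X Y (ap_endo \<phi> Z) (ap_endo \<phi> W) p
    = (h \<odot> h) X Y Z W p + (h \<odot> h) X Y (ap_endo \<phi> Z) (ap_endo \<phi> W) p"
  using ap_two_nabla_nabla_phi[OF assms, of p] ap_two_nabla_nabla_phi[OF assms(2,1,3-6), of p]
    ap_two_nabla_phi_phi[OF lie_bracket_closed[OF assms(1,2)] assms(3-6), of p] assms(1-4)
  by (simp add: curvature4_eq ap_endo_closed kulkarni_nomizu_def algebra_simps)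

end

theorem theorem3p1:
  fixes atlas :: "('m::{t2_space,second_countable_topology}, 'e::euclidean_space) chart set"
    and n :: nat and \<phi> :: "'m endo_field" and \<xi> :: "'m vector_field"
    and \<eta> :: "'m one_form" and g :: "'m two_tensor" and nabla :: "'m connection"
    and x y z w :: "'m vector_field"
  assumes "class_U atlas n \<phi> \<xi> \<eta> g nabla"
    and "x \<in> vector_fields atlas" and "y \<in> vector_fields atlas"
    and "z \<in> vector_fields atlas" and "w \<in> vector_fields atlas"
  shows "let h = nabla_form nabla \<eta>; \<Phi> = ap_endo \<phi>; R = curvature4 g nabla
    in \<forall>p. 2 * R x y (\<Phi> (\<Phi> z)) (\<Phi> (\<Phi> w)) p + 2 * R x y (\<Phi> z) (\<Phi> w) p
         = (h \<odot> h) x y z w p + (h \<odot> h) x y (\<Phi> z) (\<Phi> w) p"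
proof -
  interpret class_U atlas n \<phi> \<xi> \<eta> g nabla by fact
  \<comment> \<open>Each product contains one \<open>h\<close> with \<phi>\<phi>z and one with
    \<phi>\<phi>w, so the two signs from \<open>h_phi_phi\<close> cancel.\<close>
  have "(h \<odot> h) x y (ap_endo \<phi> (ap_endo \<phi> z)) (ap_endo \<phi> (ap_endo \<phi> w)) p = (h \<odot> h) x y z w p" for p
    using assms(2-5) by (simp add: kulkarni_nomizu_def h_phi_phi)
  then show ?thesis
    using curvature4_add_curvature4_phi[OF assms(2,3) ap_endo_closed[OF assms(4)]
        ap_endo_closed[OF assms(5)] eta_phi[OF assms(4)] eta_phi[OF assms(5)]]
    by (simp add: Let_def add.commute)
qed

end
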